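(* Let the number of samples $N_2$ and the confidence level $\lambda\in(0,1)$ be predefined constants, and let $\epsilon:\{0,1,\dots,N_2\}\to[0,1]$ be a function such that $$\epsilon(N_2)=1,\qquad \sum_{k=0}^{N_2-1}\binom{N_2}{k}\bigl(1-\epsilon(k)\bigr)^{N_2-k}=\lambda .$$ Let $\delta_1,\dots,\delta_{N_2}$ be drawn independently from $\Omega$ according to $\mathbb{P}_\Omega$, let $\Omega_{N_2}=\{\delta_1,\dots,\delta_{N_2}\}$, let $a_{N_2}^*$ be the optimizer of $$\sup_{a\in\ell_{2e}}\ \frac{1}{N_2}\sum_{i=1}^{N_2}\|y_p(\delta_i)\|_{\ell_2}^2\quad\text{s.t.}\quad \|y_r(\delta)\|_{\ell_2}^2\le 1\ \text{ and }\ x(\delta)[\infty]=0\quad \forall\,\delta\in\Omega_{N_2},$$ and let $s_{N_2}^*$ be the cardinality of the support subsample for $(\delta_1,\dots,\delta_{N_2})$. Then $$\mathbb{P}^{N_2}\Bigl\{\ \mathbb{P}_{\Omega}\{\delta\in\Omega \;:\; a_{N_2}^*\notin\Theta_\delta\}>\epsilon(s_{N_2}^* )\ \Bigr\}\le\lambda,$$ where $\Theta_\delta=\{a\in\ell_{2e} : \|y_r(\delta)\|_{\ell_2}^2\le 1,\ x(\delta)[\infty]=0\}$.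
   Context: Uncertainty: $\Omega\subset\mathbb{R}^v$ is closed, bounded, contains $0$, and carries a probability measure $\mathbb{P}_\Omega$; $\mathbb{P}^{N_2}$ is the $N_2$-fold product measure on $\Omega^{N_2}$. Signals: $\ell_{2e}$ is the set of discrete-time signals $a:\mathbb{Z}^+\to\mathbb{R}^{n_a}$ ($\mathbb{Z}^+$ the non-negative integers) with $\sum_{k=0}^N a[k]^Ta[k]<\infty$ for all $N\in\mathbb{Z}^+$; $\|y\|_{\ell_2}^2=\sum_{k=0}^\infty y[k]^Ty[k]$; $x[\infty]=\lim_{k\to\infty}x[k]$. System: for each $\delta\in\Omega$ and attack signal $a$, the closed-loop system is $$x[k+1]=A_{cl}^\Delta x[k]+B_{cl}^\Delta a[k],\quad y_p[k]=C_p^\Delta x[k]+D_p^\Delta a[k],\quad y_r[k]=C_r^\Delta x[k]+D_r^\Delta a[k],\quad x[0]=0,$$ with state $x(\delta)$, performance output $y_p(\delta)$ and residual output $y_r(\delta)$ (all also depending on $a$). The real matrices depend on $\delta$ and are obtained from $$A_{cl}=\begin{bmatrix} A+BD_cC & BC_c & 0 \\ B_cC & A_c & 0 \\ (B_eD_c+K_e)C & B_eC_c & A_e \end{bmatrix},\quad B_{cl}=\begin{bmatrix} BB_a+BD_cD_a \\ B_cD_a \\ (B_eD_c+K_e)D_a \end{bmatrix},$$ $$C_p=\begin{bmatrix}C_J+D_JD_cC&D_JC_c&0\end{bmatrix},\ D_p=D_J(D_cD_a+B_a),\ C_r=\begin{bmatrix}(D_eD_c+E_e)C&D_eC_c&C_e\end{bmatrix},\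 D_r=(D_eD_c+E_e)D_a$$ by replacing each of the plant matrices $A,B,C,C_J,D_J$, controller matrices $A_c,B_c,C_c,D_c$ and detector matrices $A_e,B_e,K_e,C_e,D_e,E_e$, generically $X$, by $X+\Delta X(\delta)$ with $\Delta X(0)=0$. The fixed 0/1 matrices $B_a,D_a$ indicate the attacked actuator and sensor channels (either actuators or sensors are attacked, not both). Standing assumptions: the closed-loop system is stable for every $\delta\in\Omega$, and $B_{cl}^\Delta$ has full column rank. Support subsample: for each $m$, let $\mathcal{A}_m(\delta_1,\dots,\delta_m)=a_m^*$ denote the optimizer of the sampled problem in the claim with $m$ samples $\delta_1,\dots,\delta_m$ in place of $N_2$ samples. A support subsample for $(\delta_1,\dots,\delta_{N_2})$ is a tuple $(\delta_{i_1},\dots,\delta_{i_k})$, $i_1<\dots<i_k$, extracted from it that gives the same solution, i.e. $\mathcal{A}_k(\delta_{i_1},\dots,\delta_{i_k})=\mathcal{A}_{N_2}(\delta_1,\dots,\delta_{N_2})$; $s_{N_2}^*$ is the cardinality $k$ of the support subsample selected by a given rule (a function of the sample). *)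

theory Defs
  imports "HOL-Probability.Probability"
begin

definition hcat :: "real^'a^'m \<Rightarrow> real^'b^'m \<Rightarrow> real^('a + 'b)^'m" where
  "hcat M N = (\<chi> i j. case j of Inl k \<Rightarrow> M $ i $ k | Inr k \<Rightarrow> N $ i $ k)"

definition vcat :: "real^'n^'a \<Rightarrow> real^'n^'b \<Rightarrow> real^'n^('a + 'b)" where
  "vcat M N = (\<chi> i. case i of Inl k \<Rightarrow> M $ k | Inr k \<Rightarrow> N $ k)"

text \<open>
  Index types: \<open>'n\<close> plant states, \<open>'u\<close> plant inputs, \<open>'y\<close> plant outputs,
  \<open>'p\<close> performance outputs, \<open>'c\<close> controller states, \<open>'e\<close> detector states,
  \<open>'r\<close> residuals, \<open>'a\<close> attack channels.
\<close>

record ('n::finite, 'u::finite, 'y::finite, 'p::finite, 'c::finite, 'e::finite, 'r::finite) sysmats =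
  mA  :: "real^'n^'n"
  mB  :: "real^'u^'n"
  mC  :: "real^'n^'y"
  mCJ :: "real^'n^'p"
  mDJ :: "real^'u^'p"
  mAc :: "real^'c^'c"
  mBc :: "real^'y^'c"
  mCc :: "real^'c^'u"
  mDc :: "real^'y^'u"
  mAe :: "real^'e^'e"
  mBe :: "real^'u^'e"
  mKe :: "real^'y^'e"
  mCe :: "real^'e^'r"
  mDe :: "real^'u^'r"
  mEe :: "real^'y^'r"

definition zero_mats ::
  "('n::finite, 'u::finite, 'y::finite, 'p::finite, 'c::finite, 'e::finite, 'r::finite) sysmats" where
  "zero_mats = \<lparr>mA = 0, mB = 0, mC = 0, mCJ = 0, mDJ = 0, mAc = 0, mBc = 0, mCc = 0, mDc = 0,
     mAe = 0, mBe = 0, mKe = 0, mCe = 0, mDe = 0, mEe = 0\<rparr>"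

definition add_mats ::
  "('n::finite, 'u::finite, 'y::finite, 'p::finite, 'c::finite, 'e::finite, 'r::finite) sysmats
   \<Rightarrow> ('n, 'u, 'y, 'p, 'c, 'e, 'r) sysmats \<Rightarrow> ('n, 'u, 'y, 'p, 'c, 'e, 'r) sysmats" where
  "add_mats X Y =
    \<lparr>mA = mA X + mA Y, mB = mB X + mB Y, mC = mC X + mC Y, mCJ = mCJ X + mCJ Y,
     mDJ = mDJ X + mDJ Y, mAc = mAc X + mAc Y, mBc = mBc X + mBc Y, mCc = mCc X + mCc Y,
     mDc = mDc X + mDc Y, mAe = mAe X + mAe Y, mBe = mBe X + mBe Y, mKe = mKe X + mKe Y,
     mCe = mCe X + mCe Y, mDe = mDe X + mDe Y, mEe = mEe X + mEe Y\<rparr>"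

definition measurable_mats ::
  "'d measure
   \<Rightarrow> ('d \<Rightarrow> ('n::finite, 'u::finite, 'y::finite, 'p::finite, 'c::finite, 'e::finite, 'r::finite) sysmats)
   \<Rightarrow> bool" where
  "measurable_mats P X \<longleftrightarrow>
     (\<lambda>d. mA (X d)) \<in> borel_measurable P \<and> (\<lambda>d. mB (X d)) \<in> borel_measurable P \<and>
     (\<lambda>d. mC (X d)) \<in> borel_measurable P \<and> (\<lambda>d. mCJ (X d)) \<in> borel_measurable P \<and>
     (\<lambda>d. mDJ (X d)) \<in> borel_measurable P \<and> (\<lambda>d. mAc (X d)) \<in> borel_measurable P \<and>
     (\<lambda>d. mBc (X d)) \<in> borel_measurable P \<and> (\<lambda>d. mCc (X d)) \<in> borel_measurable P \<and>
     (\<lambda>d. mDc (X d)) \<in> borel_measurable P \<and> (\<lambda>d. mAe (X d)) \<in> borel_measurable P \<and>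
     (\<lambda>d. mBe (X d)) \<in> borel_measurable P \<and> (\<lambda>d. mKe (X d)) \<in> borel_measurable P \<and>
     (\<lambda>d. mCe (X d)) \<in> borel_measurable P \<and> (\<lambda>d. mDe (X d)) \<in> borel_measurable P \<and>
     (\<lambda>d. mEe (X d)) \<in> borel_measurable P"

definition Acl ::
  "('n::finite, 'u::finite, 'y::finite, 'p::finite, 'c::finite, 'e::finite, 'r::finite) sysmats
   \<Rightarrow> real^('n + ('c + 'e))^('n + ('c + 'e))" where
  "Acl X =
     vcat (hcat (mA X + mB X ** mDc X ** mC X) (hcat (mB X ** mCc X) 0))
    (vcat (hcat (mBc X ** mC X) (hcat (mAc X) 0))
          (hcat ((mBe X ** mDc X + mKe X) ** mC X) (hcat (mBe X ** mCc X) (mAe X))))"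

definition Bcl ::
  "real^'a^'u \<Rightarrow> real^'a^'y
   \<Rightarrow> ('n::finite, 'u::finite, 'y::finite, 'p::finite, 'c::finite, 'e::finite, 'r::finite) sysmats
   \<Rightarrow> real^'a^('n + ('c + 'e))" where
  "Bcl Ba Da X =
     vcat (mB X ** Ba + mB X ** mDc X ** Da)
    (vcat (mBc X ** Da)
          ((mBe X ** mDc X + mKe X) ** Da))"

definition Cp ::
  "('n::finite, 'u::finite, 'y::finite, 'p::finite, 'c::finite, 'e::finite, 'r::finite) sysmats
   \<Rightarrow> real^('n + ('c + 'e))^'p" where
  "Cp X = hcat (mCJ X + mDJ X ** mDc X ** mC X) (hcat (mDJ X ** mCc X) 0)"

definition Dp ::
  "real^'a^'u \<Rightarrow> real^'a^'y
   \<Rightarrow> ('n::finite, 'u::finite, 'y::finite, 'p::finite, 'c::finite, 'e::finite, 'r::finite) sysmats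
   \<Rightarrow> real^'a^'p" where
  "Dp Ba Da X = mDJ X ** (mDc X ** Da + Ba)"

definition Cr ::
  "('n::finite, 'u::finite, 'y::finite, 'p::finite, 'c::finite, 'e::finite, 'r::finite) sysmats
   \<Rightarrow> real^('n + ('c + 'e))^'r" where
  "Cr X = hcat ((mDe X ** mDc X + mEe X) ** mC X) (hcat (mDe X ** mCc X) (mCe X))"

definition Dr ::
  "real^'a^'y
   \<Rightarrow> ('n::finite, 'u::finite, 'y::finite, 'p::finite, 'c::finite, 'e::finite, 'r::finite) sysmats
   \<Rightarrow> real^'a^'r" where
  "Dr Da X = (mDe X ** mDc X + mEe X) ** Da"

text \<open>Asymptotic stability of \<open>x[k+1] = M x[k]\<close>: all eigenvalues lie in the open unit disc.\<close>

definition schur_stable :: "real^'s^'s \<Rightarrow> bool" where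
  "schur_stable M \<longleftrightarrow>
     (\<forall>(z::complex) (v::complex^'s).
        v \<noteq> 0 \<and> map_matrix complex_of_real M *v v = z *s v \<longrightarrow> cmod z < 1)"

type_synonym 'a signal = "nat \<Rightarrow> real^'a"

definition l2e :: "'a::finite signal set" where
  "l2e = {a. \<forall>N. (\<Sum>k\<le>N. ennreal (a k \<bullet> a k)) < \<infinity>}"

definition l2sq :: "'a::finite signal \<Rightarrow> ennreal" where
  "l2sq y = (\<Sum>k. ennreal (y k \<bullet> y k))"

primrec state :: "real^'s^'s \<Rightarrow> real^'a^'s \<Rightarrow> 'a signal \<Rightarrow> nat \<Rightarrow> real^'s" where
  "state M N a 0 = 0"
| "state M N a (Suc k) = M *v state M N a k + N *v a k"

definition cl_state ::
  "real^'a^'u \<Rightarrow> real^'a^'y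
   \<Rightarrow> ('n::finite, 'u::finite, 'y::finite, 'p::finite, 'c::finite, 'e::finite, 'r::finite) sysmats
   \<Rightarrow> 'a signal \<Rightarrow> ('n + ('c + 'e)) signal" where
  "cl_state Ba Da X a = state (Acl X) (Bcl Ba Da X) a"

definition perf_out ::
  "real^'a^'u \<Rightarrow> real^'a^'y
   \<Rightarrow> ('n::finite, 'u::finite, 'y::finite, 'p::finite, 'c::finite, 'e::finite, 'r::finite) sysmats
   \<Rightarrow> 'a signal \<Rightarrow> 'p signal" where
  "perf_out Ba Da X a k = Cp X *v cl_state Ba Da X a k + Dp Ba Da X *v a k"

definition resid_out ::
  "real^'a^'u \<Rightarrow> real^'a^'y
   \<Rightarrow> ('n::finite, 'u::finite, 'y::finite, 'p::finite, 'c::finite, 'e::finite, 'r::finite) sysmats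
   \<Rightarrow> 'a signal \<Rightarrow> 'r signal" where
  "resid_out Ba Da X a k = Cr X *v cl_state Ba Da X a k + Dr Da X *v a k"

definition Theta ::
  "real^'a^'u \<Rightarrow> real^'a^'y
   \<Rightarrow> ('n::finite, 'u::finite, 'y::finite, 'p::finite, 'c::finite, 'e::finite, 'r::finite) sysmats
   \<Rightarrow> 'a signal set" where
  "Theta Ba Da X =
     {a \<in> l2e. l2sq (resid_out Ba Da X a) \<le> 1 \<and> cl_state Ba Da X a \<longlonglongrightarrow> 0}"

text \<open>
  The sampled problem for an \<open>m\<close>-tuple \<open>ds\<close>, used at the indices \<open>0, \<dots>, m - 1\<close>;
  \<open>X d\<close> are the system matrices at the uncertainty value \<open>d\<close>.
\<close>

definition feasible_attacks ::
  "real^'a^'u \<Rightarrow> real^'a^'y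
   \<Rightarrow> ('d \<Rightarrow> ('n::finite, 'u::finite, 'y::finite, 'p::finite, 'c::finite, 'e::finite, 'r::finite) sysmats)
   \<Rightarrow> nat \<Rightarrow> (nat \<Rightarrow> 'd) \<Rightarrow> 'a signal set" where
  "feasible_attacks Ba Da X m ds =
     {a \<in> l2e. \<forall>d \<in> ds ` {..<m}.
        l2sq (resid_out Ba Da (X d) a) \<le> 1 \<and> cl_state Ba Da (X d) a \<longlonglongrightarrow> 0}"

text \<open>For \<open>m = 0\<close> the average is \<open>0 / 0 = 0\<close>, so every element of \<^const>\<open>l2e\<close> is then an optimizer.\<close>

definition avg_perf ::
  "real^'a^'u \<Rightarrow> real^'a^'y
   \<Rightarrow> ('d \<Rightarrow> ('n::finite, 'u::finite, 'y::finite, 'p::finite, 'c::finite, 'e::finite, 'r::finite) sysmats)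
   \<Rightarrow> nat \<Rightarrow> (nat \<Rightarrow> 'd) \<Rightarrow> 'a signal \<Rightarrow> ennreal" where
  "avg_perf Ba Da X m ds a = (\<Sum>i<m. l2sq (perf_out Ba Da (X (ds i)) a)) / of_nat m"

definition is_optimizer ::
  "real^'a^'u \<Rightarrow> real^'a^'y
   \<Rightarrow> ('d \<Rightarrow> ('n::finite, 'u::finite, 'y::finite, 'p::finite, 'c::finite, 'e::finite, 'r::finite) sysmats)
   \<Rightarrow> nat \<Rightarrow> (nat \<Rightarrow> 'd) \<Rightarrow> 'a signal \<Rightarrow> bool" where
  "is_optimizer Ba Da X m ds a \<longleftrightarrow>
     a \<in> feasible_attacks Ba Da X m ds \<and>
     avg_perf Ba Da X m ds a = (SUP b \<in> feasible_attacks Ba Da X m ds. avg_perf Ba Da X m ds b)"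

text \<open>
  The tuple \<open>(ds i\<^sub>1, \<dots>, ds i\<^sub>k)\<close> for \<open>I = {i\<^sub>1 < \<dots> < i\<^sub>k}\<close>, re-indexed by \<open>0, \<dots>, k - 1\<close>.
\<close>

definition subsample :: "(nat \<Rightarrow> 'd) \<Rightarrow> nat set \<Rightarrow> nat \<Rightarrow> 'd" where
  "subsample ds I = (\<lambda>j \<in> {..<card I}. ds (sorted_list_of_set I ! j))"

text \<open>\<open>Opt m\<close> is the solution map for \<open>m\<close> samples; no minimality of \<open>I\<close> is required.\<close>

definition is_support_subsample ::
  "(nat \<Rightarrow> (nat \<Rightarrow> 'd) \<Rightarrow> 'a signal) \<Rightarrow> nat \<Rightarrow> (nat \<Rightarrow> 'd) \<Rightarrow> nat set \<Rightarrow> bool" where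
  "is_support_subsample Opt N ds I \<longleftrightarrow>
     I \<subseteq> {..<N} \<and> Opt (card I) (subsample ds I) = Opt N ds"

end

theory Submission
  imports Defs
begin

text \<open>
  If \<open>I\<close> indexes a support subsample, the decision depends only on the samples in \<open>I\<close>, and it is
  feasible for the remaining \<open>N - card I\<close> samples, which are independent of it. A decision whose
  violation probability exceeds \<open>e\<close> survives these with probability at most
  \<open>(1 - e) ^ (N - card I)\<close>. The union bound over all proper subsets \<open>I\<close> gives the binomial sum;
  \<open>I = {..<N}\<close> contributes nothing because \<open>\<epsilon> N = 1\<close>.
\<close>

subsection \<open>A scenario bound for abstract decisions\<close>

lemma sorted_list_of_set_nth_mem:
  "finite I \<Longrightarrow> j < card I \<Longrightarrow> sorted_list_of_set I ! j \<in> I"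
  by (metis length_sorted_list_of_set nth_mem set_sorted_list_of_set)

text \<open>The ambient index set \<open>K\<close> is left free because two instances occur:
  \<open>K = {..<N}\<close> for the whole sample, and \<open>K = I\<close> once the remaining
  coordinates have been split off.\<close>

lemma measurable_subsample:
  assumes "finite I" "I \<subseteq> K"
  shows "(\<lambda>ds. subsample ds I) \<in> measurable (Pi\<^sub>M K (\<lambda>_. M)) (Pi\<^sub>M {..<card I} (\<lambda>_. M))"
  unfolding subsample_def
  using assms sorted_list_of_set_nth_mem[OF assms(1)]
  by (intro measurable_restrict measurable_component_singleton) auto

text \<open>Re-indexing reads only coordinates in \<open>I\<close>, where
  \<open>merge I J (u, w)\<close> agrees with \<open>u\<close>. Hence a decision computed from the
  subsample does not depend on the fresh draws \<open>w\<close>.\<close>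

lemma subsample_merge:
  assumes "finite I"
  shows "subsample (merge I J (u, w)) I = subsample u I"
  unfolding subsample_def using sorted_list_of_set_nth_mem[OF assms]
  by (auto simp: merge_def fun_eq_iff restrict_def)

text \<open>The draws are independent, so the box has the product of its side probabilities as
  measure, and each side has probability at most \<open>1 - e\<close>.\<close>

lemma (in prob_space) prob_survive_le:
  assumes "finite J"
    and G: "{d \<in> space M. G d} \<in> sets M"
    and e: "0 \<le> e" "e \<le> prob {d \<in> space M. \<not> G d}"
  shows "emeasure (Pi\<^sub>M J (\<lambda>_. M)) (\<Pi>\<^sub>E j\<in>J. {d \<in> space M. G d}) \<le> ennreal ((1 - e) ^ card J)"
proof -
  interpret PJ: product_prob_space "\<lambda>_. M" J ..
  have "prob {d \<in> space M. \<not> G d} = 1 - prob {d \<in> space M. G d}"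
    using prob_neg[OF G] by simp
  then have le: "prob {d \<in> space M. G d} \<le> 1 - e"
    using e by simp
  have "emeasure (Pi\<^sub>M J (\<lambda>_. M)) (\<Pi>\<^sub>E j\<in>J. {d \<in> space M. G d}) = (\<Prod>j\<in>J. emeasure M {d \<in> space M. G d})"
    using assms(1) G by (intro PJ.emeasure_PiM) auto
  also have "\<dots> = ennreal (prob {d \<in> space M. G d} ^ card J)"
    by (simp add: emeasure_eq_measure ennreal_power)
  also have "\<dots> \<le> ennreal ((1 - e) ^ card J)"
    using le by (intro ennreal_leI power_mono) auto
  finally show ?thesis .
qed

text \<open>With \<open>I\<close> fixed in advance, the decision is a function of the coordinates in
  \<open>I\<close> alone. Conditioning on these freezes it, and the other \<open>N - card I\<close>
  draws must then all avoid its violation set. The event is phrased with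
  \<open>subsample ds I\<close> rather than with the full sample to make this independence
  available.\<close>

lemma (in prob_space) scenario_bound_fixed_support:
  fixes sel :: "(nat \<Rightarrow> 'a) \<Rightarrow> 'z" and N :: nat
  assumes I: "I \<subseteq> {..<N}"
    and meas: "{z \<in> space (Pi\<^sub>M {..<card I} (\<lambda>_. M) \<Otimes>\<^sub>M M). good (sel (fst z)) (snd z)}
      \<in> sets (Pi\<^sub>M {..<card I} (\<lambda>_. M) \<Otimes>\<^sub>M M)"
    and "0 \<le> e" "e \<le> 1"
  defines "E \<equiv> {ds \<in> space (Pi\<^sub>M {..<N} (\<lambda>_. M)).
      prob {d \<in> space M. \<not> good (sel (subsample ds I)) d} > e \<and>
      (\<forall>i\<in>{..<N} - I. good (sel (subsample ds I)) (ds i))}"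
  shows "E \<in> sets (Pi\<^sub>M {..<N} (\<lambda>_. M))"
    and "measure (Pi\<^sub>M {..<N} (\<lambda>_. M)) E \<le> (1 - e) ^ (N - card I)"
proof -
  have fin: "finite I" using I finite_subset by blast
  define J where "J = {..<N} - I"
  have finJ: "finite J" and disj: "I \<inter> J = {}" and un: "I \<union> J = {..<N}"
    and cardJ: "card J = N - card I"
    using I fin by (auto simp: J_def card_Diff_subset)
  interpret PP: product_prob_space "\<lambda>_. M" "{..<N}" ..
  interpret PI: prob_space "Pi\<^sub>M I (\<lambda>_. M)" by (intro prob_space_PiM prob_space_axioms)
  interpret PJ: prob_space "Pi\<^sub>M J (\<lambda>_. M)" by (intro prob_space_PiM prob_space_axioms)
  let ?Pk = "Pi\<^sub>M {..<card I} (\<lambda>_. M)" and ?PN = "Pi\<^sub>M {..<N} (\<lambda>_. M)"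
  \<comment> \<open>Pulls \<open>meas\<close> back along a pair of maps. Three sources
    \<open>L\<close> occur below: the whole sample with one further draw, the whole sample tested at
    its own coordinate \<open>i\<close>, and a single draw with the subsample held constant.\<close>
  have good_meas: "{x \<in> space L. good (sel (f x)) (g x)} \<in> sets L"
    if "f \<in> measurable L ?Pk" "g \<in> measurable L M" for f g and L :: "'l measure"
  proof -
    have "(\<lambda>x. (f x, g x)) \<in> measurable L (?Pk \<Otimes>\<^sub>M M)"
      using that by (rule measurable_Pair)
    from measurable_sets_Collect[OF this meas] show ?thesis by simp
  qed
  have sub: "(\<lambda>ds. subsample ds I) \<in> measurable ?PN ?Pk"
    using measurable_subsample[OF fin I] .
  have [measurable]: "(\<lambda>ds. prob {d \<in> space M. \<not> good (sel (subsample ds I)) d}) \<in> borel_measurable ?PN"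
  proof (rule measurable_measure)
    \<comment> \<open>The violation probability is the measure of a section of this set, so joint
      measurability of the set makes it a measurable function of the sample.\<close>
    have "{x \<in> space (?PN \<Otimes>\<^sub>M M). \<not> good (sel (subsample (fst x) I)) (snd x)} \<in> sets (?PN \<Otimes>\<^sub>M M)"
      by (intro sets.sets_Collect good_meas measurable_compose[OF measurable_fst sub] measurable_snd)
    also have "{x \<in> space (?PN \<Otimes>\<^sub>M M). \<not> good (sel (subsample (fst x) I)) (snd x)}
      = {x \<in> space (?PN \<Otimes>\<^sub>M M). snd x \<in> {d \<in> space M. \<not> good (sel (subsample (fst x) I)) d}}"
      by (auto simp: space_pair_measure)
    finally show "\<dots> \<in> sets (?PN \<Otimes>\<^sub>M M)" .
  qed auto
  have [measurable]: "Measurable.pred ?PN (\<lambda>ds. good (sel (subsample ds I)) (ds i))" if "i < N" for i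
    unfolding pred_def
    by (intro good_meas sub measurable_component_singleton) (use that in auto)
  show E: "E \<in> sets ?PN"
    unfolding E_def using finJ by (fold J_def) (measurable, auto simp: J_def)
  have mrg: "merge I J \<in> measurable (Pi\<^sub>M I (\<lambda>_. M) \<Otimes>\<^sub>M Pi\<^sub>M J (\<lambda>_. M)) ?PN"
    using measurable_merge[of I J "\<lambda>_. M"] unfolding un .
  let ?E' = "merge I J -` E \<inter> space (Pi\<^sub>M I (\<lambda>_. M) \<Otimes>\<^sub>M Pi\<^sub>M J (\<lambda>_. M))"
  \<comment> \<open>The sample splits into independent blocks over \<open>I\<close> and
    \<open>J\<close>. By Fubini it suffices to bound the section of the event at each fixed block
    \<open>u\<close> over \<open>I\<close>.\<close>
  have "emeasure ?PN E = emeasure (distr (Pi\<^sub>M I (\<lambda>_. M) \<Otimes>\<^sub>M Pi\<^sub>M J (\<lambda>_. M)) ?PN (merge I J)) E"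
    using PP.distr_merge[OF disj fin finJ] unfolding un by simp
  also have "\<dots> = emeasure (Pi\<^sub>M I (\<lambda>_. M) \<Otimes>\<^sub>M Pi\<^sub>M J (\<lambda>_. M)) ?E'"
    by (rule emeasure_distr[OF mrg E])
  also have "\<dots> = (\<integral>\<^sup>+u. emeasure (Pi\<^sub>M J (\<lambda>_. M)) (Pair u -` ?E') \<partial>Pi\<^sub>M I (\<lambda>_. M))"
    by (rule PJ.emeasure_pair_measure_alt) (rule measurable_sets[OF mrg E])
  also have "\<dots> \<le> (\<integral>\<^sup>+u. ennreal ((1 - e) ^ (N - card I)) \<partial>Pi\<^sub>M I (\<lambda>_. M))"
  proof (rule nn_integral_mono)
    fix u assume u: "u \<in> space (Pi\<^sub>M I (\<lambda>_. M))"
    let ?G = "good (sel (subsample u I))"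
    show "emeasure (Pi\<^sub>M J (\<lambda>_. M)) (Pair u -` ?E') \<le> ennreal ((1 - e) ^ (N - card I))"
    \<comment> \<open>This condition depends on \<open>u\<close> alone. If it holds, the section
      lies in the box of draws that all satisfy \<open>?G\<close>; otherwise the section is
      empty.\<close>
    proof (cases "prob {d \<in> space M. \<not> ?G d} > e")
      case True
      have G: "{d \<in> space M. ?G d} \<in> sets M"
      proof (rule good_meas[OF measurable_const measurable_ident_sets[OF refl]])
        show "subsample u I \<in> space ?Pk"
          by (rule measurable_space[OF measurable_subsample[OF fin order_refl] u])
      qed
      have "Pair u -` ?E' \<subseteq> (\<Pi>\<^sub>E j\<in>J. {d \<in> space M. ?G d})"
      proof
        fix w assume w: "w \<in> Pair u -` ?E'"
        then have "\<forall>i\<in>J. ?G (merge I J (u, w) i)"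
          using fin by (auto simp: E_def subsample_merge J_def)
        moreover have "merge I J (u, w) i = w i" if "i \<in> J" for i
          using that disj by (auto simp: merge_def)
        moreover have "w \<in> (\<Pi>\<^sub>E j\<in>J. space M)"
          using w u by (simp add: space_pair_measure space_PiM)
        ultimately show "w \<in> (\<Pi>\<^sub>E j\<in>J. {d \<in> space M. ?G d})"
          by (auto simp: PiE_iff)
      qed
      then have "emeasure (Pi\<^sub>M J (\<lambda>_. M)) (Pair u -` ?E')
          \<le> emeasure (Pi\<^sub>M J (\<lambda>_. M)) (\<Pi>\<^sub>E j\<in>J. {d \<in> space M. ?G d})"
        using G finJ by (intro emeasure_mono sets_PiM_I_finite) auto
      also have "\<dots> \<le> ennreal ((1 - e) ^ card J)"
        using True \<open>0 \<le> e\<close> by (intro prob_survive_le finJ G) auto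
      finally show ?thesis by (simp add: cardJ)
    next
      case False
      then have "Pair u -` ?E' = {}"
        using fin by (auto simp: E_def subsample_merge)
      then show ?thesis by simp
    qed
  qed
  also have "\<dots> = ennreal ((1 - e) ^ (N - card I))"
    by (simp add: PI.emeasure_space_1)
  finally have *: "emeasure ?PN E \<le> ennreal ((1 - e) ^ (N - card I))" .
  \<comment> \<open>Since \<open>e \<le> 1\<close>, the bound is nonnegative, as the passage from
    \<open>ennreal\<close> back to reals requires.\<close>
  show "measure ?PN E \<le> (1 - e) ^ (N - card I)"
    using * \<open>e \<le> 1\<close> unfolding measure_def by (intro enn2real_leI) auto
qed

section \<open>Union bound over the proper index sets\<close>

lemma sum_proper_subsets_by_card:
  fixes f :: "nat \<Rightarrow> real"
  shows "(\<Sum>I | I \<subset> {..<N}. f (card I)) = (\<Sum>k<N. real (N choose k) * f k)"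
proof -
  have fin: "finite {I. I \<subset> {..<N}}"
    by (rule finite_subset[of _ "Pow {..<N}"]) auto
  have "card I < N" if "I \<subset> {..<N}" for I
    using psubset_card_mono[OF finite_lessThan that] by simp
  then have "(\<Sum>I | I \<subset> {..<N}. f (card I)) =
      (\<Sum>k<N. \<Sum>I | I \<in> {I. I \<subset> {..<N}} \<and> card I = k. f (card I))"
    using fin by (intro sum.group[symmetric]) auto
  also have "\<dots> = (\<Sum>k<N. real (N choose k) * f k)"
  proof (rule sum.cong)
    fix k assume "k \<in> {..<N}"
    \<comment> \<open>Because \<open>k < N\<close>, a subset with \<open>k\<close> elements is
      automatically proper, so the binomial coefficient counts the whole group.\<close>
    then have "{I. I \<in> {I. I \<subset> {..<N}} \<and> card I = k} = {I. I \<subseteq> {..<N} \<and> card I = k}"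
      by auto
    then show "(\<Sum>I | I \<in> {I. I \<subset> {..<N}} \<and> card I = k. f (card I)) = real (N choose k) * f k"
      using n_subsets[of "{..<N}" k] by simp
  qed simp
  finally show ?thesis .
qed

text \<open>The selected index set \<open>idx ds\<close> varies with the sample, which would destroy
  independence. Covering the bad event by the events for all fixed proper \<open>I\<close> restores
  it, at the price of summing over \<open>I\<close>.\<close>

theorem (in prob_space) scenario_bound:
  fixes sel :: "nat \<Rightarrow> (nat \<Rightarrow> 'a) \<Rightarrow> 'z" and N :: nat and \<epsilon> :: "nat \<Rightarrow> real"
  assumes meas: "\<And>k. k < N \<Longrightarrow>
      {z \<in> space (Pi\<^sub>M {..<k} (\<lambda>_. M) \<Otimes>\<^sub>M M). good (sel k (fst z)) (snd z)}
        \<in> sets (Pi\<^sub>M {..<k} (\<lambda>_. M) \<Otimes>\<^sub>M M)"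
    and eps: "\<And>k. k < N \<Longrightarrow> \<epsilon> k \<in> {0..1}" "\<epsilon> N = 1"
    and feas: "\<And>ds i. ds \<in> {..<N} \<rightarrow>\<^sub>E space M \<Longrightarrow> i < N \<Longrightarrow> good (sel N ds) (ds i)"
    and supp: "\<And>ds. ds \<in> {..<N} \<rightarrow>\<^sub>E space M \<Longrightarrow>
      idx ds \<subseteq> {..<N} \<and> sel (card (idx ds)) (subsample ds (idx ds)) = sel N ds"
  shows "measure (Pi\<^sub>M {..<N} (\<lambda>_. M))
      {ds \<in> {..<N} \<rightarrow>\<^sub>E space M. prob {d \<in> space M. \<not> good (sel N ds) d} > \<epsilon> (card (idx ds))}
    \<le> (\<Sum>k<N. real (N choose k) * (1 - \<epsilon> k) ^ (N - k))"
proof -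
  interpret PN: prob_space "Pi\<^sub>M {..<N} (\<lambda>_. M)" by (intro prob_space_PiM prob_space_axioms)
  define E where "E I = {ds \<in> space (Pi\<^sub>M {..<N} (\<lambda>_. M)).
      prob {d \<in> space M. \<not> good (sel (card I) (subsample ds I)) d} > \<epsilon> (card I) \<and>
      (\<forall>i\<in>{..<N} - I. good (sel (card I) (subsample ds I)) (ds i))}" for I
  have card_less: "card I < N" if "I \<subset> {..<N}" for I
    using psubset_card_mono[OF finite_lessThan that] by simp
  have E: "E I \<in> PN.events" "PN.prob (E I) \<le> (1 - \<epsilon> (card I)) ^ (N - card I)"
    if "I \<subset> {..<N}" for I
    using scenario_bound_fixed_support[of I N good "sel (card I)" "\<epsilon> (card I)"]
      that meas[OF card_less[OF that]] eps(1)[OF card_less[OF that]]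
    unfolding E_def by auto
  have fin: "finite {I. I \<subset> {..<N}}"
    by (rule finite_subset[of _ "Pow {..<N}"]) auto
  let ?B = "{ds \<in> {..<N} \<rightarrow>\<^sub>E space M. prob {d \<in> space M. \<not> good (sel N ds) d} > \<epsilon> (card (idx ds))}"
  have "?B \<subseteq> (\<Union>I\<in>{I. I \<subset> {..<N}}. E I)"
  proof
    fix ds assume B: "ds \<in> ?B"
    then have ds: "ds \<in> {..<N} \<rightarrow>\<^sub>E space M" by simp
    have "\<epsilon> (card (idx ds)) < prob {d \<in> space M. \<not> good (sel N ds) d}"
      using B by simp
    \<comment> \<open>A probability strictly above the threshold forces the threshold below 1,
      whereas selecting all \<open>N\<close> indices would give the threshold
      \<open>\<epsilon> N = 1\<close>.\<close>
    moreover from this have "\<epsilon> (card (idx ds)) < 1"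
      using prob_le_1 by (rule less_le_trans)
    then have "idx ds \<noteq> {..<N}"
      using eps(2) by (metis card_lessThan less_irrefl)
    \<comment> \<open>By \<open>supp\<close>, the decision from the subsample is the full decision:
      it inherits the large violation probability, and by \<open>feas\<close> it is good for every
      sample, in particular for those outside \<open>idx ds\<close>.\<close>
    ultimately have "idx ds \<subset> {..<N}" "ds \<in> E (idx ds)"
      using supp[OF ds] feas[OF ds] ds by (simp_all add: E_def space_PiM psubset_eq)
    then show "ds \<in> (\<Union>I\<in>{I. I \<subset> {..<N}}. E I)"
      by blast
  qed
  \<comment> \<open>Monotonicity asks for measurability of the larger set, here a finite union of
    the events \<open>E I\<close>.\<close>
  then have "PN.prob ?B \<le> PN.prob (\<Union>I\<in>{I. I \<subset> {..<N}}. E I)"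
    using E(1) fin by (intro PN.finite_measure_mono sets.finite_UN) auto
  also have "\<dots> \<le> (\<Sum>I | I \<subset> {..<N}. PN.prob (E I))"
    using E(1) fin by (intro PN.finite_measure_subadditive_finite) auto
  also have "\<dots> \<le> (\<Sum>I | I \<subset> {..<N}. (1 - \<epsilon> (card I)) ^ (N - card I))"
    using E(2) by (intro sum_mono) auto
  also have "\<dots> = (\<Sum>k<N. real (N choose k) * (1 - \<epsilon> k) ^ (N - k))"
    by (rule sum_proper_subsets_by_card[where f = "\<lambda>k. (1 - \<epsilon> k) ^ (N - k)"])
  finally show ?thesis .
qed

subsection \<open>Measurability of the feasibility constraint\<close>

text \<open>Basis vectors of the product are supported in a single coordinate, so pairing with one
  reads off that coordinate. Entries may be vectors themselves, so that two applications cover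
  matrices, which are vectors of rows.\<close>

lemma borel_measurable_vec_iff:
  fixes f :: "'x \<Rightarrow> 'b::euclidean_space^'m"
  shows "f \<in> borel_measurable L \<longleftrightarrow> (\<forall>i. (\<lambda>x. f x $ i) \<in> borel_measurable L)"
proof
  assume f: "f \<in> borel_measurable L"
  have "continuous_on UNIV (\<lambda>v::'b^'m. v $ i)" for i
    by (intro continuous_intros)
  from borel_measurable_continuous_on[OF this f]
  show "\<forall>i. (\<lambda>x. f x $ i) \<in> borel_measurable L" by blast
next
  assume f: "\<forall>i. (\<lambda>x. f x $ i) \<in> borel_measurable L"
  then show "f \<in> borel_measurable L"
    unfolding borel_measurable_euclidean_space[of f]
    by (auto simp: Basis_vec_def inner_axis intro!: borel_measurable_inner borel_measurable_const)
qed

lemma borel_measurable_mat_iff: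
  fixes f :: "'x \<Rightarrow> real^'n^'m"
  shows "f \<in> borel_measurable L \<longleftrightarrow> (\<forall>i j. (\<lambda>x. f x $ i $ j) \<in> borel_measurable L)"
  by (simp add: borel_measurable_vec_iff)

lemma borel_measurable_matrix_matrix_mult [measurable (raw)]:
  fixes f :: "'x \<Rightarrow> real^'n^'m" and g :: "'x \<Rightarrow> real^'k^'n"
  assumes "f \<in> borel_measurable L" "g \<in> borel_measurable L"
  shows "(\<lambda>x. f x ** g x) \<in> borel_measurable L"
  using assms unfolding borel_measurable_mat_iff matrix_matrix_mult_def
  by (auto intro!: borel_measurable_sum borel_measurable_times)

lemma borel_measurable_matrix_vector_mult [measurable (raw)]:
  fixes f :: "'x \<Rightarrow> real^'n^'m" and g :: "'x \<Rightarrow> real^'n"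
  assumes "f \<in> borel_measurable L" "g \<in> borel_measurable L"
  shows "(\<lambda>x. f x *v g x) \<in> borel_measurable L"
  using assms unfolding borel_measurable_vec_iff matrix_vector_mult_def
  by (auto intro!: borel_measurable_sum borel_measurable_times)

lemma borel_measurable_hcat [measurable (raw)]:
  fixes f :: "'x \<Rightarrow> real^'a^'m" and g :: "'x \<Rightarrow> real^'b^'m"
  assumes "f \<in> borel_measurable L" "g \<in> borel_measurable L"
  shows "(\<lambda>x. hcat (f x) (g x)) \<in> borel_measurable L"
  using assms unfolding borel_measurable_mat_iff hcat_def
  by (auto simp: split_sum_all)

lemma borel_measurable_vcat [measurable (raw)]:
  fixes f :: "'x \<Rightarrow> real^'n^'a" and g :: "'x \<Rightarrow> real^'n^'b"
  assumes "f \<in> borel_measurable L" "g \<in> borel_measurable L"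
  shows "(\<lambda>x. vcat (f x) (g x)) \<in> borel_measurable L"
  using assms unfolding borel_measurable_mat_iff vcat_def
  by (auto simp: split_sum_all)

lemma borel_measurable_state:
  fixes f :: "'x \<Rightarrow> real^'s^'s" and g :: "'x \<Rightarrow> real^'a^'s"
  assumes [measurable]: "f \<in> borel_measurable L" "g \<in> borel_measurable L"
    "\<And>k. (\<lambda>x. a x k) \<in> borel_measurable L"
  shows "(\<lambda>x. state (f x) (g x) (a x) k) \<in> borel_measurable L"
  by (induction k) simp_all

text \<open>Testing convergence only at the radii \<open>1 / Suc n\<close> turns it into countably
  many conditions on countably many measurable functions.\<close>

lemma pred_tendsto_zero:
  fixes f :: "'x \<Rightarrow> nat \<Rightarrow> 'b::euclidean_space"
  assumes [measurable]: "\<And>k. (\<lambda>x. f x k) \<in> borel_measurable L"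
  shows "Measurable.pred L (\<lambda>x. f x \<longlonglongrightarrow> 0)"
proof -
  have "f x \<longlonglongrightarrow> 0 \<longleftrightarrow> (\<forall>n. \<forall>\<^sub>F k in sequentially. norm (f x k) < 1 / real (Suc n))" for x
  proof
    assume "f x \<longlonglongrightarrow> 0"
    then have "\<forall>\<^sub>F k in sequentially. norm (f x k) < 1 / real (Suc n)" for n
      using tendstoD[of "f x" 0 sequentially "1 / real (Suc n)"] by simp
    then show "\<forall>n. \<forall>\<^sub>F k in sequentially. norm (f x k) < 1 / real (Suc n)" by blast
  next
    assume *: "\<forall>n. \<forall>\<^sub>F k in sequentially. norm (f x k) < 1 / real (Suc n)"
    show "f x \<longlonglongrightarrow> 0"
    proof (rule tendstoI)
      fix r :: real assume "0 < r"
      then obtain n where n: "1 / real (Suc n) < r" by (rule nat_approx_posE)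
      from * have "\<forall>\<^sub>F k in sequentially. norm (f x k) < 1 / real (Suc n)" by blast
      then show "\<forall>\<^sub>F k in sequentially. dist (f x k) 0 < r"
        by (rule eventually_mono) (use n in simp)
    qed
  qed
  then show ?thesis by simp
qed

lemma measurable_mats_add:
  assumes "measurable_mats P Y"
  shows "measurable_mats P (\<lambda>d. add_mats X0 (Y d))"
  using assms unfolding measurable_mats_def add_mats_def sysmats.simps
  by (intro conjI borel_measurable_add borel_measurable_const) blast+

text \<open>A finite sum of \<open>ennreal\<close> values of reals is finite. Membership in
  \<open>Theta\<close> thus reduces to the energy bound and the limit condition.\<close>

lemma l2e_eq_UNIV: "l2e = UNIV"
  by (auto simp: l2e_def)

text \<open>Measurability passes from the matrix entries to the closed-loop matrices, by recursion
  to the state at each time, and then to the residual and its energy. Both the attack and the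
  uncertainty vary with \<open>x\<close>, which gives the joint measurability that Fubini needs.
  Signals carry no sigma-algebra here, so the attack is measurable at each time separately.\<close>

lemma pred_mem_Theta:
  fixes X :: "'d \<Rightarrow> ('n::finite, 'u::finite, 'y::finite, 'p::finite, 'c::finite, 'e::finite, 'r::finite) sysmats"
    and a :: "'x \<Rightarrow> 'a::finite signal"
  assumes "measurable_mats P X" and f: "f \<in> measurable L P"
    and a [measurable]: "\<And>k. (\<lambda>x. a x k) \<in> borel_measurable L"
  shows "Measurable.pred L (\<lambda>x. a x \<in> Theta Ba Da (X (f x)))"
proof -
  have [measurable]:
    "(\<lambda>x. mA (X (f x))) \<in> borel_measurable L" "(\<lambda>x. mB (X (f x))) \<in> borel_measurable L"
    "(\<lambda>x. mC (X (f x))) \<in> borel_measurable L" "(\<lambda>x. mAc (X (f x))) \<in> borel_measurable L"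
    "(\<lambda>x. mBc (X (f x))) \<in> borel_measurable L" "(\<lambda>x. mCc (X (f x))) \<in> borel_measurable L"
    "(\<lambda>x. mDc (X (f x))) \<in> borel_measurable L" "(\<lambda>x. mAe (X (f x))) \<in> borel_measurable L"
    "(\<lambda>x. mBe (X (f x))) \<in> borel_measurable L" "(\<lambda>x. mKe (X (f x))) \<in> borel_measurable L"
    "(\<lambda>x. mCe (X (f x))) \<in> borel_measurable L" "(\<lambda>x. mDe (X (f x))) \<in> borel_measurable L"
    "(\<lambda>x. mEe (X (f x))) \<in> borel_measurable L"
    using assms(1) unfolding measurable_mats_def by (auto intro: measurable_compose[OF f])
  have [measurable]: "(\<lambda>x. cl_state Ba Da (X (f x)) (a x) k) \<in> borel_measurable L" for k
    unfolding cl_state_def Acl_def Bcl_def by (intro borel_measurable_state) measurable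
  have [measurable]: "(\<lambda>x. resid_out Ba Da (X (f x)) (a x) k) \<in> borel_measurable L" for k
    unfolding resid_out_def Cr_def Dr_def by measurable
  have [measurable]: "Measurable.pred L (\<lambda>x. cl_state Ba Da (X (f x)) (a x) \<longlonglongrightarrow> 0)"
    by (rule pred_tendsto_zero) measurable
  show ?thesis
    unfolding Theta_def l2sq_def l2e_eq_UNIV by simp
qed

section \<open>The sampled attack problem as an instance of the scenario bound\<close>

theorem mainTheorem1:
  fixes \<Omega> :: "(real^'v) set"
    and P :: "(real^'v) measure"
    and X0 :: "('n::finite, 'u::finite, 'y::finite, 'p::finite, 'c::finite, 'e::finite, 'r::finite) sysmats"
    and \<Delta>X :: "real^'v \<Rightarrow> ('n, 'u, 'y, 'p, 'c, 'e, 'r) sysmats"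
    and X :: "real^'v \<Rightarrow> ('n, 'u, 'y, 'p, 'c, 'e, 'r) sysmats"
    and Ba :: "real^'a^'u"
    and Da :: "real^'a^'y"
    and N\<^sub>2 :: nat
    and lam :: real
    and \<epsilon> :: "nat \<Rightarrow> real"
    and Opt :: "nat \<Rightarrow> (nat \<Rightarrow> real^'v) \<Rightarrow> 'a signal"
    and rule_idx :: "(nat \<Rightarrow> real^'v) \<Rightarrow> nat set"
  assumes "closed \<Omega>" and "bounded \<Omega>" and "0 \<in> \<Omega>"
    and "prob_space P" and "space P = \<Omega>" and "sets P = sets (restrict_space borel \<Omega>)"
    and "\<Delta>X 0 = zero_mats" and "measurable_mats P \<Delta>X"
    and "\<And>\<delta>. X \<delta> = add_mats X0 (\<Delta>X \<delta>)"
    and "\<And>i j. Ba $ i $ j \<in> {0, 1}" and "\<And>i j. Da $ i $ j \<in> {0, 1}"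
    and "Ba = 0 \<or> Da = 0"
    and "\<And>\<delta>. \<delta> \<in> \<Omega> \<Longrightarrow> schur_stable (Acl (X \<delta>))"
    and "\<And>\<delta>. \<delta> \<in> \<Omega> \<Longrightarrow> rank (Bcl Ba Da (X \<delta>)) = CARD('a)"
    and "0 < lam" and "lam < 1"
    and "\<And>k. k \<le> N\<^sub>2 \<Longrightarrow> \<epsilon> k \<in> {0..1}"
    and "\<epsilon> N\<^sub>2 = 1"
    and "(\<Sum>k<N\<^sub>2. real (N\<^sub>2 choose k) * (1 - \<epsilon> k) ^ (N\<^sub>2 - k)) = lam"
    and "\<And>m ds. m \<le> N\<^sub>2 \<Longrightarrow> ds \<in> {..<m} \<rightarrow>\<^sub>E \<Omega> \<Longrightarrow> is_optimizer Ba Da X m ds (Opt m ds)"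
    and "\<And>m k. m \<le> N\<^sub>2 \<Longrightarrow> (\<lambda>ds. Opt m ds k) \<in> borel_measurable (Pi\<^sub>M {..<m} (\<lambda>_. P))"
    and "\<And>ds. ds \<in> {..<N\<^sub>2} \<rightarrow>\<^sub>E \<Omega> \<Longrightarrow> is_support_subsample Opt N\<^sub>2 ds (rule_idx ds)"
    and "(\<lambda>ds. card (rule_idx ds)) \<in> measurable (Pi\<^sub>M {..<N\<^sub>2} (\<lambda>_. P)) (count_space UNIV)"
  shows "measure (Pi\<^sub>M {..<N\<^sub>2} (\<lambda>_. P))
           {ds \<in> {..<N\<^sub>2} \<rightarrow>\<^sub>E \<Omega>.
              measure P {\<delta> \<in> \<Omega>. Opt N\<^sub>2 ds \<notin> Theta Ba Da (X \<delta>)} > \<epsilon> (card (rule_idx ds))}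
         \<le> lam"
proof -
  interpret prob_space P by fact
  have X: "X = (\<lambda>\<delta>. add_mats X0 (\<Delta>X \<delta>))"
    using assms(9) by (rule ext)
  have mats: "measurable_mats P X"
    unfolding X using assms(8) by (rule measurable_mats_add)
  have "measure (Pi\<^sub>M {..<N\<^sub>2} (\<lambda>_. P))
      {ds \<in> {..<N\<^sub>2} \<rightarrow>\<^sub>E space P. prob {\<delta> \<in> space P. \<not> Opt N\<^sub>2 ds \<in> Theta Ba Da (X \<delta>)} > \<epsilon> (card (rule_idx ds))}
    \<le> (\<Sum>k<N\<^sub>2. real (N\<^sub>2 choose k) * (1 - \<epsilon> k) ^ (N\<^sub>2 - k))"
  \<comment> \<open>The decision is the optimizer and it is good for \<open>\<delta>\<close> when it
    lies in the constraint set there. Feasibility of the optimizer gives goodness at every sample,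
    the support subsample reproduces the optimizer, and the resulting binomial sum is
    \<open>lam\<close>.\<close>
  proof (rule scenario_bound[where sel = Opt and good = "\<lambda>a \<delta>. a \<in> Theta Ba Da (X \<delta>)"])
    fix k assume k: "k < N\<^sub>2"
    have "Measurable.pred (Pi\<^sub>M {..<k} (\<lambda>_. P) \<Otimes>\<^sub>M P) (\<lambda>z. Opt k (fst z) \<in> Theta Ba Da (X (snd z)))"
      using k by (intro pred_mem_Theta[OF mats] measurable_snd measurable_compose[OF measurable_fst] assms(21)) simp
    then show "{z \<in> space (Pi\<^sub>M {..<k} (\<lambda>_. P) \<Otimes>\<^sub>M P). Opt k (fst z) \<in> Theta Ba Da (X (snd z))}
        \<in> sets (Pi\<^sub>M {..<k} (\<lambda>_. P) \<Otimes>\<^sub>M P)"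
      by simp
    show "\<epsilon> k \<in> {0..1}" using assms(17) k by simp
  next
    fix ds i assume "ds \<in> {..<N\<^sub>2} \<rightarrow>\<^sub>E space P" "i < N\<^sub>2"
    then show "Opt N\<^sub>2 ds \<in> Theta Ba Da (X (ds i))"
      using assms(20)[of N\<^sub>2 ds] assms(5)
      by (auto simp: is_optimizer_def feasible_attacks_def Theta_def)
  next
    fix ds assume "ds \<in> {..<N\<^sub>2} \<rightarrow>\<^sub>E space P"
    then show "rule_idx ds \<subseteq> {..<N\<^sub>2} \<and>
        Opt (card (rule_idx ds)) (subsample ds (rule_idx ds)) = Opt N\<^sub>2 ds"
      using assms(22)[of ds] assms(5) by (simp add: is_support_subsample_def)
  qed fact
  then show ?thesis
    using assms(5,19) by simp
qed

end
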